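(* If $\alpha$ is a sequence in $\Omega$ with $S_\Omega(\alpha)\subset\Omega$, then, for any $x\in\mathbb{F}_q$, there is an automorphism $\theta_{x,\alpha}$ of $\Gamma(\Omega,q)$ such that, for any $[l]\in L(\Omega)$ and $\langle r\rangle\in R(\Omega)$, $$(\theta_{x,\alpha}([l]))_\alpha=l_\alpha+x,\qquad(\theta_{x,\alpha}(\langle r\rangle))_\alpha=r_\alpha-x,$$ and $$(\theta_{x,\alpha}([l]))_\gamma=l_\gamma,\qquad(\theta_{x,\alpha}(\langle r\rangle))_\gamma=r_\gamma$$ for $\gamma=*$ or $\gamma\in\Omega\setminus\left(\{\alpha,\alpha0,\alpha1\}\cup\{\alpha01\beta,\alpha10\beta:\beta\in\{0,1\}^*\}\right)$.
   Context: Let $q$ be a prime power and $\mathbb{F}_q$ the field with $q$ elements. $\{0,1\}^*$ is the set of finite binary sequences, $\eta$ the null sequence; juxtaposition is concatenation. $\Omega\subset\{0,1\}^*$ is a finite set satisfying condition C1: $\eta\in\Omega$, and for any $\alpha\in\Omega\setminus\{\eta\}$ the sequence obtained by deleting the last bit of $\alpha$ is in $\Omega$. $L(\Omega)$ and $R(\Omega)$ are two disjoint copies of $\mathbb{F}_q^{|\Omega|+1}$; their vectors are written $[l]$ and $\langle r\rangle$ respectively, with entries indexed by $\Omega\cup\{*\}$, where $*\notin\Omega$ is an extra symbol. $\Gamma(\Omega,q)$ is the bipartite graph with vertex set $L(\Omega)\cup R(\Omega)$ in which $[l]\in L(\Omega)$ and $\langle r\rangle\in R(\Omega)$ are adjacent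 if and only if $l_\eta+r_\eta=l_*r_*$, $l_{\alpha0}+r_{\alpha0}=r_*l_\alpha$ for all $\alpha0\in\Omega$, and $l_{\beta1}+r_{\beta1}=l_*r_\beta$ for all $\beta1\in\Omega$ (here $\alpha,\beta\in\{0,1\}^*$). The automorphism maps $L(\Omega)$ to $L(\Omega)$ and $R(\Omega)$ to $R(\Omega)$. For $\alpha\in\Omega$, $S_\Omega(\alpha)$ is the set of $\beta\in\{0,1\}^*$ with $\{\alpha01\beta,\alpha10\beta\}\cap\Omega\ne\emptyset$. *)

theory Defs
  imports Main "HOL-Library.FuncSet"
begin

text \<open>
  A binary sequence is a \<^typ>\<open>bool list\<close>, with \<^term>\<open>False\<close> for the bit 0 and
  \<^term>\<open>True\<close> for the bit 1; the first bit is the head of the list. Vector entries are indexed by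
  \<^typ>\<open>bool list option\<close>, where \<^term>\<open>None\<close> is the extra symbol \<open>*\<close>.
  The field with \<open>q\<close> elements is an arbitrary type \<open>'q\<close> of class \<open>field\<close> and \<open>finite\<close>,
  so that \<open>q\<close> is \<open>CARD('q)\<close>.
\<close>

definition C1 :: "bool list set \<Rightarrow> bool" where
  "C1 \<Omega> \<longleftrightarrow> [] \<in> \<Omega> \<and> (\<forall>\<alpha> \<in> \<Omega> - {[]}. butlast \<alpha> \<in> \<Omega>)"

definition S :: "bool list set \<Rightarrow> bool list \<Rightarrow> bool list set" where
  "S \<Omega> \<alpha> = {\<beta>. {\<alpha> @ [False, True] @ \<beta>, \<alpha> @ [True, False] @ \<beta>} \<inter> \<Omega> \<noteq> {}}"

type_synonym 'q vec = "bool list option \<Rightarrow> 'q"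

text \<open>Vectors are extensional, so that distinct functions are distinct vectors.\<close>

definition vecs :: "bool list set \<Rightarrow> 'q vec set" where
  "vecs \<Omega> = insert None (Some ` \<Omega>) \<rightarrow>\<^sub>E UNIV"

datatype 'q vertex = Lvec (entry: "'q vec") | Rvec (entry: "'q vec")

definition Lpart :: "bool list set \<Rightarrow> 'q vertex set" where
  "Lpart \<Omega> = Lvec ` vecs \<Omega>"

definition Rpart :: "bool list set \<Rightarrow> 'q vertex set" where
  "Rpart \<Omega> = Rvec ` vecs \<Omega>"

definition adjacent :: "bool list set \<Rightarrow> ('q::field) vec \<Rightarrow> 'q vec \<Rightarrow> bool" where
  "adjacent \<Omega> l r \<longleftrightarrow>
     l (Some []) + r (Some []) = l None * r None \<and>
     (\<forall>\<alpha>. \<alpha> @ [False] \<in> \<Omega> \<longrightarrow>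
        l (Some (\<alpha> @ [False])) + r (Some (\<alpha> @ [False])) = r None * l (Some \<alpha>)) \<and>
     (\<forall>\<beta>. \<beta> @ [True] \<in> \<Omega> \<longrightarrow>
        l (Some (\<beta> @ [True])) + r (Some (\<beta> @ [True])) = l None * r (Some \<beta>))"

text \<open>A simple graph is given by its vertex set and its set of two-element edges.\<close>

type_synonym 'v graph = "'v set \<times> 'v set set"

definition Gamma :: "bool list set \<Rightarrow> ('q::field) vertex graph" where
  "Gamma \<Omega> = (Lpart \<Omega> \<union> Rpart \<Omega>,
     {{Lvec l, Rvec r} | l r. l \<in> vecs \<Omega> \<and> r \<in> vecs \<Omega> \<and> adjacent \<Omega> l r})"

definition automorphism :: "'v graph \<Rightarrow> ('v \<Rightarrow> 'v) \<Rightarrow> bool" where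
  "automorphism G \<theta> \<longleftrightarrow> bij_betw \<theta> (fst G) (fst G) \<and>
     (\<forall>u \<in> fst G. \<forall>v \<in> fst G. {u, v} \<in> snd G \<longleftrightarrow> {\<theta> u, \<theta> v} \<in> snd G)"

end

theory Submission
  imports Defs "HOL-Library.Sublist"
begin

text \<open>
  Adding constants \<open>x\<close> to \<open>l\<^sub>\<alpha>\<close> and \<open>-x\<close> to \<open>r\<^sub>\<alpha>\<close> preserves the equation at
  \<open>\<alpha>\<close>, but disturbs the right-hand sides of the equations at \<open>\<alpha>0\<close> and \<open>\<alpha>1\<close> by
  \<open>x r\<^sub>*\<close> and \<open>-x l\<^sub>*\<close>. These disturbances are absorbed by \<open>r\<^sub>\<alpha>\<^sub>0\<close> and
  \<open>l\<^sub>\<alpha>\<^sub>1\<close> alone, so that nothing happens at \<open>\<alpha>00\<close> and \<open>\<alpha>11\<close>, while the equations at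
  \<open>\<alpha>01\<close> and \<open>\<alpha>10\<close> are disturbed by \<open>x l\<^sub>* r\<^sub>*\<close> and \<open>-x l\<^sub>* r\<^sub>*\<close>. On an edge,
  \<open>l\<^sub>* r\<^sub>* = l\<^sub>\<eta> + r\<^sub>\<eta>\<close>, which is a sum of a term in \<open>l\<close> and a term in \<open>r\<close>: so
  \<open>x l\<^sub>\<eta>\<close> and \<open>x r\<^sub>\<eta>\<close> can be added to the entries at \<open>\<alpha>01\<close> and subtracted from those at
  \<open>\<alpha>10\<close>. From there on, the system below \<open>\<alpha>01\<close> (and below \<open>\<alpha>10\<close>) is corrected by \<open>x\<close>
  times (\<open>-x\<close> times) a copy of the system from the root: add \<open>x l\<^sub>\<beta>\<close>, \<open>x r\<^sub>\<beta>\<close> at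
  \<open>\<alpha>01\<beta>\<close> and subtract them at \<open>\<alpha>10\<beta>\<close>. The condition on \<open>S \<Omega> \<alpha>\<close> says exactly that these
  \<open>\<beta>\<close> are indices of entries.

  Non-edges must also be mapped to non-edges. Let the defect at \<open>\<gamma>\<close> be the difference of the two sides of the
  equation at \<open>\<gamma>\<close>. The map changes the defect only at \<open>\<gamma> = \<alpha>01\<beta>\<close> and \<open>\<gamma> = \<alpha>10\<beta>\<close>, by
  \<open>\<plusminus>x\<close> times the defect at the shorter sequence \<open>\<beta>\<close> (\<open>defect_shift_mixed\<close>,
  \<open>defect_shift_other\<close>). The defects are thus transformed in a unitriangular way with respect to
  length, and vanish together before and after the map (\<open>adjacent_shift_iff\<close>). The entries
  themselves are also transformed in a unitriangular way, which gives injectivity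
  (\<open>inj_on_shift\<close>), and bijectivity follows as there are finitely many vectors.
\<close>

section \<open>The shift of a vector\<close>

text \<open>
  The amount added to the entry at \<open>\<alpha>s\<close>, as a function of \<open>s\<close>. One function serves both
  sides, because the graph is symmetric under simultaneously exchanging the two sides and the two
  bits, and \<open>x\<close> changes sign under this symmetry: take \<open>(True, x)\<close> for left vectors and
  \<open>(False, -x)\<close> for right vectors.
\<close>

fun correction :: "bool \<Rightarrow> 'q::field \<Rightarrow> 'q vec \<Rightarrow> bool list \<Rightarrow> 'q" where
  "correction b x v [] = x"
| "correction b x v [c] = (if c = b then - x * v None else 0)"
| "correction b x v (c # d # \<beta>) =
     (if c = d then 0 else (if c = b then - x else x) * v (Some \<beta>))"

definition shift :: "bool list set \<Rightarrow> bool list \<Rightarrow> bool \<Rightarrow> 'q::field \<Rightarrow> 'q vec \<Rightarrow> 'q vec" where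
  "shift \<Omega> \<alpha> b x v = restrict
     (\<lambda>i. case i of None \<Rightarrow> v None
        | Some \<gamma> \<Rightarrow> v (Some \<gamma>) +
            (if prefix \<alpha> \<gamma> then correction b x v (drop (length \<alpha>) \<gamma>) else 0))
     (insert None (Some ` \<Omega>))"

lemma shift_None [simp]: "shift \<Omega> \<alpha> b x v None = v None"
  by (simp add: shift_def)

lemma shift_append [simp]:
  "\<alpha> @ s \<in> \<Omega> \<Longrightarrow> shift \<Omega> \<alpha> b x v (Some (\<alpha> @ s)) = v (Some (\<alpha> @ s)) + correction b x v s"
  by (simp add: shift_def)

lemma shift_self [simp]: "\<alpha> \<in> \<Omega> \<Longrightarrow> shift \<Omega> \<alpha> b x v (Some \<alpha>) = v (Some \<alpha>) + x"
  using shift_append[of \<alpha> "[]"] by simp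

lemma shift_not_prefix:
  "\<gamma> \<in> \<Omega> \<Longrightarrow> \<not> prefix \<alpha> \<gamma> \<Longrightarrow> shift \<Omega> \<alpha> b x v (Some \<gamma>) = v (Some \<gamma>)"
  by (simp add: shift_def)

lemma shift_in_vecs: "shift \<Omega> \<alpha> b x v \<in> vecs \<Omega>"
  by (simp add: shift_def vecs_def)

lemma C1_snocD: "C1 \<Omega> \<Longrightarrow> \<gamma> @ [c] \<in> \<Omega> \<Longrightarrow> \<gamma> \<in> \<Omega>"
  unfolding C1_def by force

lemma S_subset_mixedD:
  assumes "S \<Omega> \<alpha> \<subseteq> \<Omega>" "\<alpha> @ c # d # \<beta> \<in> \<Omega>" "c \<noteq> d"
  shows "\<beta> \<in> \<Omega>"
  using assms by (cases c; cases d) (auto simp: S_def)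

lemma shift_fixes:
  assumes "\<gamma> \<in> \<Omega>"
    and "\<gamma> \<notin> {\<alpha>, \<alpha> @ [False], \<alpha> @ [True]} \<union>
      (\<Union>\<beta>. {\<alpha> @ [False, True] @ \<beta>, \<alpha> @ [True, False] @ \<beta>})"
  shows "shift \<Omega> \<alpha> b x v (Some \<gamma>) = v (Some \<gamma>)"
proof (cases "prefix \<alpha> \<gamma>")
  case True
  then obtain s where s: "\<gamma> = \<alpha> @ s" by (auto simp: prefix_def)
  have "correction b x v s = 0"
    (* The rule splits s into the shapes [], [c] and c # d # \<beta>. *)
  proof (cases s rule: remdups_adj.cases)
    case (2 c)
    then show ?thesis using assms(2) s by (cases c) auto
  next
    case (3 c d \<beta>)
    then show ?thesis using assms(2) s by (cases c; cases d) auto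
  qed (use assms(2) s in auto)
  then show ?thesis using assms(1) s by simp
qed (simp add: shift_not_prefix assms(1))

text \<open>
  The correction of an entry involves only the entry at \<open>*\<close> and entries at shorter sequences, so a
  vector can be recovered from its shift by recursion on length.
\<close>

lemma inj_on_shift:
  assumes S: "S \<Omega> \<alpha> \<subseteq> \<Omega>"
  shows "inj_on (shift \<Omega> \<alpha> b x) (vecs \<Omega>)"
proof (rule inj_onI)
  fix v w
  assume v: "v \<in> vecs \<Omega>" and w: "w \<in> vecs \<Omega>" and eq: "shift \<Omega> \<alpha> b x v = shift \<Omega> \<alpha> b x w"
  have star: "v None = w None" using eq by (metis shift_None)
  have "\<gamma> \<in> \<Omega> \<Longrightarrow> v (Some \<gamma>) = w (Some \<gamma>)" for \<gamma>
  proof (induction \<gamma> rule: length_induct)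
    case (1 \<gamma>)
    show ?case
    proof (cases "prefix \<alpha> \<gamma>")
      case True
      then obtain s where s: "\<gamma> = \<alpha> @ s" by (auto simp: prefix_def)
      have "correction b x v s = correction b x w s"
      proof (cases "(b, x, v, s)" rule: correction.cases)
        case (3 _ _ _ c d \<beta>)
        then have "c \<noteq> d \<Longrightarrow> \<beta> \<in> \<Omega>"
          using S_subset_mixedD[OF S] "1.prems" s by auto
        then have "c \<noteq> d \<Longrightarrow> v (Some \<beta>) = w (Some \<beta>)"
          using "1.IH" 3 s by auto
        then show ?thesis using 3 by auto
      qed (use star in auto)
      moreover have "v (Some \<gamma>) + correction b x v s = w (Some \<gamma>) + correction b x w s"
        using eq "1.prems" s by (metis shift_append)
      ultimately show ?thesis by simp
    next
      case False
      then show ?thesis using eq "1.prems" by (metis shift_not_prefix)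
    qed
  qed
  with star v w show "v = w"
    unfolding vecs_def by (intro PiE_ext) auto
qed

lemma bij_betw_shift:
  assumes "finite \<Omega>" "S \<Omega> \<alpha> \<subseteq> \<Omega>"
  shows "bij_betw (shift \<Omega> \<alpha> b (x :: 'q::{field,finite})) (vecs \<Omega>) (vecs \<Omega>)"
proof -
  have "finite (vecs \<Omega> :: 'q vec set)"
    unfolding vecs_def using assms(1) by (intro finite_PiE) auto
  then have "shift \<Omega> \<alpha> b x ` vecs \<Omega> = vecs \<Omega>"
    using inj_on_shift[OF assms(2)] by (intro endo_inj_surj) (auto simp: shift_in_vecs)
  then show ?thesis
    using inj_on_shift[OF assms(2)] by (simp add: bij_betw_def)
qed

section \<open>Adjacency of shifted vectors\<close>

definition defect :: "('q::field) vec \<Rightarrow> 'q vec \<Rightarrow> bool list \<Rightarrow> 'q" where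
  "defect l r \<gamma> = l (Some \<gamma>) + r (Some \<gamma>) -
     (if \<gamma> = [] then l None * r None
      else if last \<gamma> then l None * r (Some (butlast \<gamma>))
      else r None * l (Some (butlast \<gamma>)))"

lemma defect_Nil: "defect l r [] = l (Some []) + r (Some []) - l None * r None"
  by (simp add: defect_def)

lemma defect_snoc:
  "defect l r (\<gamma> @ [c]) = l (Some (\<gamma> @ [c])) + r (Some (\<gamma> @ [c])) -
     (if c then l None * r (Some \<gamma>) else r None * l (Some \<gamma>))"
  by (simp add: defect_def)

lemma adjacent_iff_defect:
  assumes "C1 \<Omega>"
  shows "adjacent \<Omega> l r \<longleftrightarrow> (\<forall>\<gamma> \<in> \<Omega>. defect l r \<gamma> = 0)"
proof
  assume adj: "adjacent \<Omega> l r"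
  show "\<forall>\<gamma> \<in> \<Omega>. defect l r \<gamma> = 0"
  proof
    fix \<gamma> assume "\<gamma> \<in> \<Omega>"
    with adj show "defect l r \<gamma> = 0"
      by (cases \<gamma> rule: rev_cases) (auto simp: adjacent_def defect_Nil defect_snoc)
  qed
next
  assume zero: "\<forall>\<gamma> \<in> \<Omega>. defect l r \<gamma> = 0"
  have "[] \<in> \<Omega>" using assms by (simp add: C1_def)
  then have "defect l r [] = 0" using zero by blast
  moreover have "defect l r (\<gamma> @ [c]) = 0" if "\<gamma> @ [c] \<in> \<Omega>" for \<gamma> c
    using zero that by blast
  ultimately show "adjacent \<Omega> l r"
    unfolding adjacent_def by (fastforce simp: defect_Nil defect_snoc)
qed

lemma defect_shift_snoc:
  assumes C1: "C1 \<Omega>" and mem: "\<alpha> @ s @ [e] \<in> \<Omega>"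
  shows "defect (shift \<Omega> \<alpha> True x l) (shift \<Omega> \<alpha> False y r) (\<alpha> @ s @ [e]) =
    defect l r (\<alpha> @ s @ [e]) + correction True x l (s @ [e]) + correction False y r (s @ [e]) -
    (if e then l None * correction False y r s else r None * correction True x l s)"
proof -
  have pred: "\<alpha> @ s \<in> \<Omega>" using C1_snocD[OF C1, of "\<alpha> @ s" e] mem by simp
  have unfold: "defect v w (\<alpha> @ s @ [e]) = v (Some (\<alpha> @ s @ [e])) + w (Some (\<alpha> @ s @ [e])) -
      (if e then v None * w (Some (\<alpha> @ s)) else w None * v (Some (\<alpha> @ s)))" for v w :: "'a vec"
    using defect_snoc[of v w "\<alpha> @ s" e] by simp
  show ?thesis
    unfolding unfold shift_append[OF mem] shift_append[OF pred] by (simp add: algebra_simps)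
qed

text \<open>
  Up to sign, the corrections at \<open>\<alpha>01\<beta>\<close> and \<open>\<alpha>10\<beta>\<close> are \<open>x\<close> times the terms of the equation at
  \<open>\<beta>\<close>. For \<open>\<beta> = \<eta>\<close> the product \<open>l\<^sub>* r\<^sub>*\<close> in that equation comes from the corrections at
  \<open>\<alpha>0\<close> and \<open>\<alpha>1\<close>.
\<close>

lemma defect_shift_mixed:
  assumes C1: "C1 \<Omega>" and mem: "\<alpha> @ c # (\<not> c) # \<beta> \<in> \<Omega>"
  shows "defect (shift \<Omega> \<alpha> True x l) (shift \<Omega> \<alpha> False (- x) r) (\<alpha> @ c # (\<not> c) # \<beta>) =
    defect l r (\<alpha> @ c # (\<not> c) # \<beta>) + (if c then - x else x) * defect l r \<beta>"
proof (cases \<beta> rule: rev_cases)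
  case Nil
  then show ?thesis
    using defect_shift_snoc[OF C1, of \<alpha> "[c]" "\<not> c" x l "- x" r] mem
    by (cases c) (simp_all add: defect_Nil algebra_simps)
next
  case (snoc \<beta>' e)
  then show ?thesis
    using defect_shift_snoc[OF C1, of \<alpha> "c # (\<not> c) # \<beta>'" e x l "- x" r] mem
    by (cases c; cases e) (simp_all add: defect_snoc algebra_simps)
qed

lemma defect_shift_other:
  assumes C1: "C1 \<Omega>" and mem: "\<gamma> \<in> \<Omega>" and other: "\<And>c \<beta>. \<gamma> \<noteq> \<alpha> @ c # (\<not> c) # \<beta>"
  shows "defect (shift \<Omega> \<alpha> True x l) (shift \<Omega> \<alpha> False (- x) r) \<gamma> = defect l r \<gamma>"
proof (cases \<gamma> rule: rev_cases)
  case Nil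
  then show ?thesis
    using mem by (cases "\<alpha> = []") (auto simp: defect_Nil shift_not_prefix)
next
  case (snoc \<delta> e)
  have \<delta>: "\<delta> \<in> \<Omega>" using C1_snocD[OF C1] mem snoc by simp
  show ?thesis
  proof (cases "prefix \<alpha> \<delta>")
    case True
    then obtain s where s: "\<delta> = \<alpha> @ s" by (auto simp: prefix_def)
    note change = defect_shift_snoc[OF C1, of \<alpha> s e x l "- x" r]
    show ?thesis
    proof (cases s rule: remdups_adj.cases)
      case 1
      then show ?thesis using change mem snoc s by auto
    next
      case (2 c)
      then have "e = c" using other[of c "[]"] snoc s by auto
      then show ?thesis using change mem snoc s 2 by auto
    next
      case (3 c d \<beta>)
      then have "d = c" using other[of c "\<beta> @ [e]"] snoc s by auto
      then show ?thesis using change mem snoc s 3 by auto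
    qed
  next
    case False
    then show ?thesis
      using mem \<delta> snoc by (cases "\<alpha> = \<gamma>") (auto simp: defect_snoc shift_not_prefix)
  qed
qed

lemma adjacent_shift_iff:
  assumes C1: "C1 \<Omega>" and S: "S \<Omega> \<alpha> \<subseteq> \<Omega>"
  shows "adjacent \<Omega> (shift \<Omega> \<alpha> True x l) (shift \<Omega> \<alpha> False (- x) r) \<longleftrightarrow> adjacent \<Omega> l r"
    (is "adjacent \<Omega> ?l ?r \<longleftrightarrow> _")
proof -
  have iff: "(\<forall>\<gamma> \<in> \<Omega>. defect ?l ?r \<gamma> = 0) \<longleftrightarrow> (\<forall>\<gamma> \<in> \<Omega>. defect l r \<gamma> = 0)"
  proof
    assume zero: "\<forall>\<gamma> \<in> \<Omega>. defect l r \<gamma> = 0"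
    show "\<forall>\<gamma> \<in> \<Omega>. defect ?l ?r \<gamma> = 0"
    proof
      fix \<gamma> assume mem: "\<gamma> \<in> \<Omega>"
      show "defect ?l ?r \<gamma> = 0"
      proof (cases "\<exists>c \<beta>. \<gamma> = \<alpha> @ c # (\<not> c) # \<beta>")
        case True
        then obtain c \<beta> where \<gamma>: "\<gamma> = \<alpha> @ c # (\<not> c) # \<beta>" by blast
        then have "\<beta> \<in> \<Omega>" using S_subset_mixedD[OF S] mem by blast
        then show ?thesis using defect_shift_mixed[OF C1, of \<alpha> c \<beta> x l r] mem zero \<gamma> by simp
      next
        case False
        then show ?thesis using defect_shift_other[OF C1 mem, of \<alpha> x l r] mem zero by simp
      qed
    qed
  next
    assume zero: "\<forall>\<gamma> \<in> \<Omega>. defect ?l ?r \<gamma> = 0"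
    have "\<gamma> \<in> \<Omega> \<Longrightarrow> defect l r \<gamma> = 0" for \<gamma>
    proof (induction \<gamma> rule: length_induct)
      case (1 \<gamma>)
      show ?case
      proof (cases "\<exists>c \<beta>. \<gamma> = \<alpha> @ c # (\<not> c) # \<beta>")
        case True
        then obtain c \<beta> where \<gamma>: "\<gamma> = \<alpha> @ c # (\<not> c) # \<beta>" by blast
        then have "\<beta> \<in> \<Omega>" using S_subset_mixedD[OF S] "1.prems" by blast
        then have "defect l r \<beta> = 0" using "1.IH" \<gamma> by simp
        then show ?thesis
          using defect_shift_mixed[OF C1, of \<alpha> c \<beta> x l r] "1.prems" zero \<gamma> by simp
      next
        case False
        then show ?thesis
          using defect_shift_other[OF C1 "1.prems", of \<alpha> x l r] "1.prems" zero by simp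
      qed
    qed
    then show "\<forall>\<gamma> \<in> \<Omega>. defect l r \<gamma> = 0" by blast
  qed
  then show ?thesis by (simp add: adjacent_iff_defect[OF C1])
qed

section \<open>The automorphism\<close>

fun map_sides :: "('q vec \<Rightarrow> 'q vec) \<Rightarrow> ('q vec \<Rightarrow> 'q vec) \<Rightarrow> 'q vertex \<Rightarrow> 'q vertex" where
  "map_sides f g (Lvec l) = Lvec (f l)"
| "map_sides f g (Rvec r) = Rvec (g r)"

lemma map_sides_Lpart:
  assumes "f ` vecs \<Omega> = vecs \<Omega>"
  shows "map_sides f g ` Lpart \<Omega> = Lpart \<Omega>"
proof -
  have "map_sides f g ` Lpart \<Omega> = Lvec ` f ` vecs \<Omega>"
    by (simp add: Lpart_def image_image)
  then show ?thesis by (simp add: assms Lpart_def)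
qed

lemma map_sides_Rpart:
  assumes "g ` vecs \<Omega> = vecs \<Omega>"
  shows "map_sides f g ` Rpart \<Omega> = Rpart \<Omega>"
proof -
  have "map_sides f g ` Rpart \<Omega> = Rvec ` g ` vecs \<Omega>"
    by (simp add: Rpart_def image_image)
  then show ?thesis by (simp add: assms Rpart_def)
qed

lemma Gamma_edge_iff:
  "{Lvec l, Rvec r} \<in> snd (Gamma \<Omega>) \<longleftrightarrow> l \<in> vecs \<Omega> \<and> r \<in> vecs \<Omega> \<and> adjacent \<Omega> l r"
  "{Rvec r, Lvec l} \<in> snd (Gamma \<Omega>) \<longleftrightarrow> l \<in> vecs \<Omega> \<and> r \<in> vecs \<Omega> \<and> adjacent \<Omega> l r"
  "{Lvec l, Lvec l'} \<notin> snd (Gamma \<Omega>)"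
  "{Rvec r, Rvec r'} \<notin> snd (Gamma \<Omega>)"
  by (auto simp: Gamma_def doubleton_eq_iff)

lemma automorphism_map_sides:
  fixes f g :: "('q::field) vec \<Rightarrow> 'q vec"
  assumes f: "bij_betw f (vecs \<Omega>) (vecs \<Omega>)" and g: "bij_betw g (vecs \<Omega>) (vecs \<Omega>)"
    and adj: "\<And>l r. l \<in> vecs \<Omega> \<Longrightarrow> r \<in> vecs \<Omega> \<Longrightarrow>
      adjacent \<Omega> (f l) (g r) \<longleftrightarrow> adjacent \<Omega> l r"
  shows "automorphism (Gamma \<Omega>) (map_sides f g)"
  unfolding automorphism_def
proof (intro conjI ballI)
  have "map_sides f g ` (Lpart \<Omega> \<union> Rpart \<Omega>) = Lpart \<Omega> \<union> Rpart \<Omega>"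
    using f g by (simp add: image_Un map_sides_Lpart map_sides_Rpart bij_betw_def)
  moreover have "inj_on (map_sides f g) (Lpart \<Omega> \<union> Rpart \<Omega>)"
    using bij_betw_imp_inj_on[OF f] bij_betw_imp_inj_on[OF g]
    by (auto simp: Lpart_def Rpart_def intro!: inj_onI dest: inj_onD)
  ultimately show "bij_betw (map_sides f g) (fst (Gamma \<Omega>)) (fst (Gamma \<Omega>))"
    by (simp add: bij_betw_def Gamma_def)
next
  fix u v :: "'q vertex"
  assume u: "u \<in> fst (Gamma \<Omega>)" and v: "v \<in> fst (Gamma \<Omega>)"
  have f_mem: "f l \<in> vecs \<Omega>" and g_mem: "g l \<in> vecs \<Omega>" if "l \<in> vecs \<Omega>" for l
    using bij_betwE[OF f] bij_betwE[OF g] that by blast+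
  show "{u, v} \<in> snd (Gamma \<Omega>) \<longleftrightarrow> {map_sides f g u, map_sides f g v} \<in> snd (Gamma \<Omega>)"
  proof -
    have "u \<in> Lvec ` vecs \<Omega> \<union> Rvec ` vecs \<Omega>" "v \<in> Lvec ` vecs \<Omega> \<union> Rvec ` vecs \<Omega>"
      using u v by (simp_all add: Gamma_def Lpart_def Rpart_def)
    then show ?thesis
      by (elim UnE imageE) (simp_all add: Gamma_edge_iff adj f_mem g_mem)
  qed
qed

theorem lemma2:
  fixes \<Omega> :: "bool list set" and \<alpha> :: "bool list" and x :: "'q::{field,finite}"
  assumes "finite \<Omega>" and "C1 \<Omega>" and "\<alpha> \<in> \<Omega>" and "S \<Omega> \<alpha> \<subseteq> \<Omega>"
  shows "\<exists>\<theta> :: 'q vertex \<Rightarrow> 'q vertex.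
    automorphism (Gamma \<Omega>) \<theta> \<and> \<theta> ` Lpart \<Omega> = Lpart \<Omega> \<and> \<theta> ` Rpart \<Omega> = Rpart \<Omega> \<and>
    (\<forall>l \<in> vecs \<Omega>. \<forall>r \<in> vecs \<Omega>.
       entry (\<theta> (Lvec l)) (Some \<alpha>) = l (Some \<alpha>) + x \<and>
       entry (\<theta> (Rvec r)) (Some \<alpha>) = r (Some \<alpha>) - x \<and>
       (\<forall>\<gamma> \<in> insert None (Some ` (\<Omega> -
            ({\<alpha>, \<alpha> @ [False], \<alpha> @ [True]} \<union>
             (\<Union>\<beta>. {\<alpha> @ [False, True] @ \<beta>, \<alpha> @ [True, False] @ \<beta>})))).
          entry (\<theta> (Lvec l)) \<gamma> = l \<gamma> \<and> entry (\<theta> (Rvec r)) \<gamma> = r \<gamma>))"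
proof -
  let ?f = "shift \<Omega> \<alpha> True x" and ?g = "shift \<Omega> \<alpha> False (- x)"
  have f: "bij_betw ?f (vecs \<Omega>) (vecs \<Omega>)" and g: "bij_betw ?g (vecs \<Omega>) (vecs \<Omega>)"
    using bij_betw_shift assms(1,4) by blast+
  have "automorphism (Gamma \<Omega>) (map_sides ?f ?g)"
    using f g adjacent_shift_iff[OF assms(2,4)] by (rule automorphism_map_sides)
  moreover have "map_sides ?f ?g ` Lpart \<Omega> = Lpart \<Omega>" "map_sides ?f ?g ` Rpart \<Omega> = Rpart \<Omega>"
    using f g by (simp_all add: map_sides_Lpart map_sides_Rpart bij_betw_def)
  moreover have "shift \<Omega> \<alpha> b y v \<gamma> = v \<gamma>"
    if "\<gamma> \<in> insert None (Some ` (\<Omega> - ({\<alpha>, \<alpha> @ [False], \<alpha> @ [True]} \<union>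
        (\<Union>\<beta>. {\<alpha> @ [False, True] @ \<beta>, \<alpha> @ [True, False] @ \<beta>}))))" for b y v \<gamma>
    using that
    by (elim insertE imageE DiffE; hypsubst) (rule shift_None, rule shift_fixes)
  ultimately show ?thesis
    using assms(3)
    by (intro exI[of _ "map_sides ?f ?g"] conjI ballI)
      (simp_all only: map_sides.simps vertex.sel shift_self diff_conv_add_uminus)
qed

end
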